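(* Let $r\ge 2$ and let $H$ be a connected $r$-uniform hypergraph with spectral radius $\rho$ and principal eigenvector $x$. Let $u,v\in V(H)$ with $d(u,v)=\ell$. Then the following statements hold. (1) If $\rho>\sqrt[r]{4}$, then $$\left(\frac{\sigma-\sigma^{-1}}{\sigma^{\ell+1}-\sigma^{-(\ell+1)}}\right)^{\frac{2}{r}}\le\frac{x_u}{x_v}\le\left(\frac{\sigma^{\ell+1}-\sigma^{-(\ell+1)}}{\sigma-\sigma^{-1}}\right)^{\frac{2}{r}},$$ where $\sigma=\frac12\left(\sqrt{\rho^r}+\sqrt{\rho^r-4}\right)$. (2) If $\rho=\sqrt[r]{4}$, then $$\frac{1}{\sqrt[r]{(\ell+1)^2}}\le\frac{x_u}{x_v}\le\sqrt[r]{(\ell+1)^2}.$$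
   Context: A hypergraph $H=(V(H),E(H))$ on $n$ vertices has vertex set $V(H)=[n]=\{1,\dots,n\}$ (after labelling) and a set $E(H)$ of edges, which are subsets of $V(H)$; it is $r$-uniform if every edge contains exactly $r$ vertices. A path is an alternating sequence $v_1e_1v_2e_2\cdots v_\ell e_\ell v_{\ell+1}$ with $v_i,v_{i+1}\in e_i$ for $1\le i\le \ell$, all vertices and all edges in it being distinct; its length is the number $\ell$ of its edges. $H$ is connected if any two vertices are joined by a path, and the distance $d(u,v)$ is the length of a shortest path connecting $u$ and $v$ (with $d(u,u)=0$). The adjacency tensor $\mathcal{A}(H)$ is the order $r$, dimension $n$ tensor whose $(i_1i_2\cdots i_r)$-entry is $\frac{1}{(r-1)!}$ if $\{i_1,\dots,i_r\}\in E(H)$ and $0$ otherwise. For an order $r$ dimension $n$ tensor $\mathcal{A}=(a_{i_1\cdots i_r})$ and $x\in\mathbb{C}^n$, $\mathcal{A}x$ is the vector in $\mathbb{C}^n$ with $(\mathcal{A}x)_i=\sum_{i_2,\dots,i_r=1}^n a_{ii_2\cdots i_r}x_{i_2}\cdots x_{i_r}$. A number $\lambda\in\mathbb{C}$ is an eigenvalue of $\mathcal{A}$ with eigenvector $x\neq 0$ if $(\mathcal{A}x)_i=\lambda x_i^{r-1}$ for all $i$. The spectral radius $\rho(H)$ is the maximum modulus of the eigenvalues of $\mathcal{A}(H)$. For connected $H$, the principal eigenvector of $H$ is the unique eigenvector $x$ of $\mathcal{A}(H)$ corresponding to $\rho(H)$ with all entries positive and $\|x\|_r=\left(\sum_i x_i^r\right)^{1/r}=1$;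 $x_v$ denotes its entry at vertex $v$. *)

theory Defs
  imports Complex_Main
begin

text \<open>
  A hypergraph is given by its number of vertices \<open>n\<close> (the vertex set is \<open>{1..n}\<close>)
  and its edge set \<open>E\<close>.
\<close>

definition hypergraph :: "nat \<Rightarrow> nat set set \<Rightarrow> bool" where
  "hypergraph n E \<longleftrightarrow> (\<forall>e\<in>E. e \<subseteq> {1..n})"

definition uniform :: "nat \<Rightarrow> nat set set \<Rightarrow> bool" where
  "uniform r E \<longleftrightarrow> (\<forall>e\<in>E. card e = r)"

text \<open>
  The path $v_1 e_1 v_2 \ldots v_\ell e_\ell v_{\ell+1}$ is represented by the lists
  \<open>vs\<close> of its vertices and \<open>es\<close> of its edges; its length is \<open>length es\<close>.
  Since lists are indexed from 0, edge \<open>es ! i\<close> joins \<open>vs ! i\<close> and \<open>vs ! Suc i\<close>.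
  A single vertex is a path of length 0, so every vertex has distance 0 from itself.
\<close>

definition is_path :: "nat \<Rightarrow> nat set set \<Rightarrow> nat list \<Rightarrow> nat set list \<Rightarrow> bool" where
  "is_path n E vs es \<longleftrightarrow>
     length vs = length es + 1 \<and> set vs \<subseteq> {1..n} \<and> set es \<subseteq> E \<and>
     distinct vs \<and> distinct es \<and>
     (\<forall>i<length es. vs ! i \<in> es ! i \<and> vs ! Suc i \<in> es ! i)"

definition joined :: "nat \<Rightarrow> nat set set \<Rightarrow> nat \<Rightarrow> nat \<Rightarrow> nat \<Rightarrow> bool" where
  "joined n E u v l \<longleftrightarrow>
     (\<exists>vs es. is_path n E vs es \<and> hd vs = u \<and> last vs = v \<and> length es = l)"

definition connected_hypergraph :: "nat \<Rightarrow> nat set set \<Rightarrow> bool" where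
  "connected_hypergraph n E \<longleftrightarrow> (\<forall>u\<in>{1..n}. \<forall>v\<in>{1..n}. \<exists>l. joined n E u v l)"

definition distance :: "nat \<Rightarrow> nat set set \<Rightarrow> nat \<Rightarrow> nat \<Rightarrow> nat" where
  "distance n E u v = (LEAST l. joined n E u v l)"

text \<open>
  A tensor of order \<open>r\<close> and dimension \<open>n\<close> maps index lists of length \<open>r\<close> over \<open>{1..n}\<close>
  to entries; vectors of dimension \<open>n\<close> are functions of which only the values on
  \<open>{1..n}\<close> are relevant.
\<close>

type_synonym tensor = "nat list \<Rightarrow> complex"

definition tensor_apply :: "nat \<Rightarrow> nat \<Rightarrow> tensor \<Rightarrow> (nat \<Rightarrow> complex) \<Rightarrow> nat \<Rightarrow> complex" where
  "tensor_apply r n A x i =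
     (\<Sum>js | length js = r - 1 \<and> set js \<subseteq> {1..n}. A (i # js) * prod_list (map x js))"

definition is_eigenvector ::
    "nat \<Rightarrow> nat \<Rightarrow> tensor \<Rightarrow> complex \<Rightarrow> (nat \<Rightarrow> complex) \<Rightarrow> bool" where
  "is_eigenvector r n A c x \<longleftrightarrow>
     (\<exists>i\<in>{1..n}. x i \<noteq> 0) \<and> (\<forall>i\<in>{1..n}. tensor_apply r n A x i = c * x i ^ (r - 1))"

definition is_eigenvalue :: "nat \<Rightarrow> nat \<Rightarrow> tensor \<Rightarrow> complex \<Rightarrow> bool" where
  "is_eigenvalue r n A c \<longleftrightarrow> (\<exists>x. is_eigenvector r n A c x)"

definition adjacency_tensor :: "nat \<Rightarrow> nat set set \<Rightarrow> tensor" where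
  "adjacency_tensor r E is = (if set is \<in> E then 1 / fact (r - 1) else 0)"

definition spectral_radius :: "nat \<Rightarrow> nat \<Rightarrow> nat set set \<Rightarrow> real" where
  "spectral_radius r n E =
     (GREATEST t. \<exists>c. is_eigenvalue r n (adjacency_tensor r E) c \<and> t = cmod c)"

text \<open>
  For a connected uniform hypergraph exactly one vector on \<open>{1..n}\<close> satisfies the
  following predicate, by the Perron--Frobenius theorem for nonnegative tensors.
\<close>

definition principal_eigenvector :: "nat \<Rightarrow> nat \<Rightarrow> nat set set \<Rightarrow> (nat \<Rightarrow> real) \<Rightarrow> bool" where
  "principal_eigenvector r n E x \<longleftrightarrow>
     is_eigenvector r n (adjacency_tensor r E)
       (complex_of_real (spectral_radius r n E)) (\<lambda>i. complex_of_real (x i)) \<and>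
     (\<forall>i\<in>{1..n}. x i > 0) \<and>
     root r (\<Sum>i\<in>{1..n}. x i ^ r) = 1"

end

theory Submission
  imports Defs "HOL-Combinatorics.Multiset_Permutations"
begin

text \<open>
  The proof compares entries of the positive eigenvector along a path between the vertices. Write
  \<open>w\<^sub>e\<close> for the product of the entries of \<open>x\<close> over an edge \<open>e\<close>. Multiplying the eigenvalue
  equation at \<open>i\<close> by \<open>x\<^sub>i\<close> turns it into \<open>\<rho> x\<^sub>i\<^sup>r = (\<Sum>e\<ni>i. w\<^sub>e)\<close>. In particular every vertex of an
  edge satisfies \<open>\<rho> x\<^sub>j\<^sup>r \<ge> w\<^sub>e\<close>; using this for all vertices of \<open>e\<close> but two, \<open>a\<close> and \<open>b\<close>, yields
  a lower bound for \<open>w\<^sub>e\<close> in terms of \<open>x\<^sub>a\<close> and \<open>x\<^sub>b\<close> alone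
  (\<open>edge_weight_ge\<close>). Number the vertices of a path from \<open>0\<close>, and let \<open>y\<^sub>k\<close> be the square root
  of the \<open>r\<close>-th power of the entry at the \<open>k\<close>-th one. With \<open>s = sqrt (\<rho>\<^sup>r)\<close>, the equation at an
  inner vertex, where two distinct edges of the path meet, then becomes the linear inequality
  \<open>y\<^sub>k + y\<^sub>k\<^sub>+\<^sub>2 \<le> s y\<^sub>k\<^sub>+\<^sub>1\<close>, and at the first vertex \<open>y\<^sub>1 \<le> s y\<^sub>0\<close>.

  So along the path \<open>y\<close> grows at most as fast as the solution of the recurrence
  \<open>U\<^sub>k\<^sub>+\<^sub>2 = s U\<^sub>k\<^sub>+\<^sub>1 - U\<^sub>k\<close> with \<open>U\<^sub>0 = 1\<close> and \<open>U\<^sub>1 = s\<close>, as long as that solution stays positive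
  (\<open>recurrence_comparison\<close>). It does for \<open>s \<ge> 2\<close>: if \<open>s = \<sigma> + 1/\<sigma>\<close> with \<open>\<sigma> > 1\<close>, then
  \<open>U\<^sub>k = (\<sigma>\<^sup>k\<^sup>+\<^sup>1 - \<sigma>\<^sup>-\<^sup>(\<^sup>k\<^sup>+\<^sup>1\<^sup>)) / (\<sigma> - \<sigma>\<^sup>-\<^sup>1)\<close>, and if \<open>s = 2\<close>, then \<open>U\<^sub>k = k + 1\<close>. Taking a
  path of length \<open>d(u,v)\<close> gives the upper bounds, and exchanging \<open>u\<close> and \<open>v\<close> the lower ones.
\<close>

section \<open>Eigenvectors and edge weights\<close>

text \<open>
  The factor \<open>1/(r-1)!\<close> in the adjacency tensor compensates for the orderings of the remaining
  \<open>r - 1\<close> vertices: since edges have exactly \<open>r\<close> elements, an index list that hits an edge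
  lists these vertices without repetition.
\<close>

lemma tensor_apply_adjacency:
  assumes "hypergraph n E" "uniform r E" "r \<ge> 1"
  shows "tensor_apply r n (adjacency_tensor r E) x i = (\<Sum>e | e \<in> E \<and> i \<in> e. \<Prod>j\<in>e - {i}. x j)"
proof -
  let ?S = "{js. length js = r - 1 \<and> set js \<subseteq> {1..n}}"
  let ?F = "{e. e \<in> E \<and> i \<in> e}"
  let ?P = "\<lambda>e. permutations_of_set (e - {i})"
  let ?g = "\<lambda>js. 1 / fact (r - 1) * prod_list (map x js)"
  have sub: "e \<subseteq> {1..n}" and cd: "card e = r" if "e \<in> E" for e
    using that assms by (auto simp: hypergraph_def uniform_def)
  have finE: "finite E"
    using sub by (meson Pow_iff finite_Pow_iff finite_atLeastAtMost finite_subset subsetI)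
  have fine: "finite e" if "e \<in> E" for e
    using sub[OF that] finite_subset by blast
  have finS: "finite ?S"
    using finite_lists_length_eq[of "{1..n}" "r - 1"] by (simp add: conj_commute)
  have ce: "card (e - {i}) = r - 1" if "e \<in> ?F" for e
    using that cd fine by (auto simp: card_Diff_singleton)
  have eq: "{js \<in> ?S. set (i # js) \<in> E} = (\<Union>e\<in>?F. ?P e)"
  proof (intro subset_antisym subsetI)
    fix js assume js: "js \<in> {js \<in> ?S. set (i # js) \<in> E}"
    then have "card (set (i # js)) = length (i # js)"
      using cd[of "set (i # js)"] assms(3) by simp
    then have "distinct (i # js)" by (rule card_distinct)
    with js show "js \<in> (\<Union>e\<in>?F. ?P e)"
      by (auto simp: permutations_of_set_def intro!: exI[of _ "insert i (set js)"])
  next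
    fix js assume "js \<in> (\<Union>e\<in>?F. ?P e)"
    then obtain e where e: "e \<in> ?F" and js: "set js = e - {i}" "distinct js"
      by (auto simp: permutations_of_set_def)
    have "set (i # js) = e" using e js by auto
    moreover have "length js = r - 1"
      using ce[OF e] js distinct_card by metis
    ultimately show "js \<in> {js \<in> ?S. set (i # js) \<in> E}"
      using e js sub[of e] by auto
  qed
  have "tensor_apply r n (adjacency_tensor r E) x i = (\<Sum>js\<in>?S. if set (i # js) \<in> E then ?g js else 0)"
    unfolding tensor_apply_def adjacency_tensor_def by (intro sum.cong) auto
  also have "\<dots> = sum ?g {js \<in> ?S. set (i # js) \<in> E}"
    by (rule sum.inter_filter[symmetric, OF finS])
  also have "\<dots> = (\<Sum>e\<in>?F. sum ?g (?P e))"
    unfolding eq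
  proof (rule sum.UNION_disjoint)
    show "\<forall>e\<in>?F. \<forall>e'\<in>?F. e \<noteq> e' \<longrightarrow> ?P e \<inter> ?P e' = {}"
      by (auto simp: permutations_of_set_def)
  qed (use finE in auto)
  also have "\<dots> = (\<Sum>e\<in>?F. \<Prod>j\<in>e - {i}. x j)"
  proof (rule sum.cong[OF refl])
    fix e assume e: "e \<in> ?F"
    have "sum ?g (?P e) = (\<Sum>js\<in>?P e. 1 / fact (r - 1) * (\<Prod>j\<in>e - {i}. x j))"
      by (intro sum.cong refl) (auto simp: permutations_of_set_def prod.distinct_set_conv_list[symmetric])
    also have "\<dots> = (\<Prod>j\<in>e - {i}. x j)"
      using e fine ce[OF e] by simp
    finally show "sum ?g (?P e) = (\<Prod>j\<in>e - {i}. x j)" .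
  qed
  finally show ?thesis .
qed

lemma eigenvector_edge_equation:
  fixes x :: "nat \<Rightarrow> real"
  assumes "hypergraph n E" "uniform r E" "r \<ge> 1" "i \<in> {1..n}"
    and eig: "is_eigenvector r n (adjacency_tensor r E) (complex_of_real \<rho>) (\<lambda>i. complex_of_real (x i))"
  shows "\<rho> * x i ^ r = (\<Sum>e | e \<in> E \<and> i \<in> e. \<Prod>j\<in>e. x j)"
proof -
  have fine: "finite e" if "e \<in> E" for e
    using that assms(1) finite_subset[of e "{1..n}"] by (auto simp: hypergraph_def)
  have "tensor_apply r n (adjacency_tensor r E) (\<lambda>i. complex_of_real (x i)) i
          = complex_of_real \<rho> * complex_of_real (x i) ^ (r - 1)"
    using eig assms(4) by (simp add: is_eigenvector_def)
  then have "complex_of_real (\<Sum>e | e \<in> E \<and> i \<in> e. \<Prod>j\<in>e - {i}. x j)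
          = complex_of_real (\<rho> * x i ^ (r - 1))"
    by (simp add: tensor_apply_adjacency[OF assms(1-3)])
  then have "(\<Sum>e | e \<in> E \<and> i \<in> e. \<Prod>j\<in>e - {i}. x j) = \<rho> * x i ^ (r - 1)"
    by (simp only: of_real_eq_iff)
  then have "\<rho> * x i ^ r = x i * (\<Sum>e | e \<in> E \<and> i \<in> e. \<Prod>j\<in>e - {i}. x j)"
    using assms(3) by (cases r) auto
  also have "\<dots> = (\<Sum>e | e \<in> E \<and> i \<in> e. x i * (\<Prod>j\<in>e - {i}. x j))"
    by (rule sum_distrib_left)
  also have "\<dots> = (\<Sum>e | e \<in> E \<and> i \<in> e. \<Prod>j\<in>e. x j)"
    by (intro sum.cong refl) (auto simp: prod.remove[symmetric] fine)
  finally show ?thesis .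
qed

text \<open>
  Writing \<open>w\<close> for the product over \<open>e\<close>, the \<open>r - 2\<close> inequalities \<open>w \<le> \<rho> x\<^sub>j\<^sup>r\<close> for \<open>j\<close> other than
  \<open>a\<close> and \<open>b\<close> multiply to
  \<open>w\<^sup>r\<^sup>-\<^sup>2 x\<^sub>a\<^sup>r x\<^sub>b\<^sup>r \<le> \<rho>\<^sup>r\<^sup>-\<^sup>2 w\<^sup>r\<close>, in which \<open>w\<^sup>r\<^sup>-\<^sup>2\<close> cancels. The resulting bound
  \<open>x\<^sub>a\<^sup>r x\<^sub>b\<^sup>r \<le> \<rho>\<^sup>r\<^sup>-\<^sup>2 w\<^sup>2\<close> is stated in the form of its square root multiplied by \<open>\<rho>\<close>.
\<close>

lemma edge_weight_ge:
  fixes x :: "nat \<Rightarrow> real"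
  assumes fin: "finite e" and card: "card e = r" and ab: "a \<in> e" "b \<in> e" "a \<noteq> b" and "\<rho> > 0"
    and pos: "\<And>j. j \<in> e \<Longrightarrow> x j > 0"
    and le: "\<And>j. j \<in> e \<Longrightarrow> (\<Prod>j\<in>e. x j) \<le> \<rho> * x j ^ r"
  shows "\<rho> * sqrt (x a ^ r) * sqrt (x b ^ r) \<le> sqrt (\<rho> ^ r) * (\<Prod>j\<in>e. x j)"
proof -
  define w where "w = (\<Prod>j\<in>e. x j)"
  have w: "w > 0" unfolding w_def by (intro prod_pos pos)
  have "card {a, b} \<le> card e" using fin ab by (intro card_mono) auto
  then have r: "r = (r - 2) + 2" using ab card by simp
  have card': "card (e - {a, b}) = r - 2" using ab fin card by (simp add: card_Diff_subset)
  have "w ^ (r - 2) = (\<Prod>j\<in>e - {a, b}. w)" by (simp add: card')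
  also have "\<dots> \<le> (\<Prod>j\<in>e - {a, b}. \<rho> * x j ^ r)"
    using w le by (intro prod_mono) (auto simp: w_def[symmetric])
  also have "\<dots> = \<rho> ^ (r - 2) * (\<Prod>j\<in>e - {a, b}. x j) ^ r"
    by (simp add: prod.distrib card' prod_power_distrib)
  finally have "w ^ (r - 2) * (x a ^ r * x b ^ r)
      \<le> \<rho> ^ (r - 2) * (\<Prod>j\<in>e - {a, b}. x j) ^ r * (x a ^ r * x b ^ r)"
    using pos ab by (intro mult_right_mono) (auto intro!: mult_nonneg_nonneg zero_le_power less_imp_le)
  also have "\<dots> = \<rho> ^ (r - 2) * ((\<Prod>j\<in>e - {a, b}. x j) * (\<Prod>j\<in>{a, b}. x j)) ^ r"
    using ab by (simp add: power_mult_distrib)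
  also have "(\<Prod>j\<in>e - {a, b}. x j) * (\<Prod>j\<in>{a, b}. x j) = w"
    unfolding w_def using prod.subset_diff[of "{a, b}" e x] fin ab by simp
  also have "w ^ r = w ^ (r - 2) * w\<^sup>2" by (subst r) (simp only: power_add)
  finally have "w ^ (r - 2) * (x a ^ r * x b ^ r) \<le> w ^ (r - 2) * (\<rho> ^ (r - 2) * w\<^sup>2)"
    by (simp add: mult_ac)
  then have "x a ^ r * x b ^ r \<le> \<rho> ^ (r - 2) * w\<^sup>2"
    using w by simp
  then have "\<rho>\<^sup>2 * (x a ^ r * x b ^ r) \<le> \<rho>\<^sup>2 * (\<rho> ^ (r - 2) * w\<^sup>2)"
    by (rule mult_left_mono) simp
  also have "\<dots> = \<rho> ^ r * w\<^sup>2"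
    by (subst (2) r) (simp only: power_add mult_ac)
  finally have "sqrt (\<rho>\<^sup>2 * (x a ^ r * x b ^ r)) \<le> sqrt (\<rho> ^ r * w\<^sup>2)"
    by (rule real_sqrt_le_mono)
  then show ?thesis
    using \<open>\<rho> > 0\<close> w by (simp add: real_sqrt_mult w_def[symmetric] mult.assoc)
qed

section \<open>Comparison along a path\<close>

text \<open>
  For positive \<open>y\<close>, the ratios of consecutive terms satisfy
  \<open>y\<^sub>k\<^sub>+\<^sub>2 / y\<^sub>k\<^sub>+\<^sub>1 \<le> s - y\<^sub>k / y\<^sub>k\<^sub>+\<^sub>1 \<le> s - U\<^sub>k / U\<^sub>k\<^sub>+\<^sub>1 = U\<^sub>k\<^sub>+\<^sub>2 / U\<^sub>k\<^sub>+\<^sub>1\<close> by induction, and their product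
  telescopes. Below, these inequalities appear with denominators cleared.
\<close>

lemma recurrence_comparison:
  fixes U y :: "nat \<Rightarrow> real"
  assumes U0: "U 0 = 1" and U1: "U 1 = s" and U2: "\<And>k. U (k + 2) = s * U (k + 1) - U k"
    and pos: "\<And>k. U k > 0"
    and y1: "l \<ge> 1 \<Longrightarrow> y 1 \<le> s * y 0"
    and y2: "\<And>k. k + 2 \<le> l \<Longrightarrow> y (k + 2) + y k \<le> s * y (k + 1)"
  shows "y l \<le> U l * y 0"
proof -
  have step: "y (k + 1) * U k \<le> U (k + 1) * y k" if "k + 1 \<le> l" for k
    using that
  proof (induction k)
    case 0
    then show ?case using y1 U0 U1 by simp
  next
    case (Suc k)
    have "y (k + 2) * U (k + 1) \<le> (s * y (k + 1) - y k) * U (k + 1)"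
      using y2[of k] Suc.prems pos[of "k + 1"] by (intro mult_right_mono) auto
    also have "\<dots> \<le> s * y (k + 1) * U (k + 1) - y (k + 1) * U k"
      using Suc by (simp add: algebra_simps)
    also have "\<dots> = U (k + 2) * y (k + 1)"
      by (simp only: U2 algebra_simps)
    finally show ?case by simp
  qed
  have "y k \<le> U k * y 0" if "k \<le> l" for k
    using that
  proof (induction k)
    case 0
    then show ?case using U0 by simp
  next
    case (Suc k)
    have "U k * y (k + 1) \<le> U (k + 1) * y k"
      using step[of k] Suc.prems by (simp add: mult.commute)
    also have "\<dots> \<le> U (k + 1) * (U k * y 0)"
      using Suc pos[of "k + 1"] by (intro mult_left_mono) auto
    finally have "U k * y (k + 1) \<le> U k * (U (k + 1) * y 0)" by (simp add: mult_ac)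
    then show ?case using pos[of k] by simp
  qed
  then show ?thesis by simp
qed

text \<open>
  The edges of a path are distinct, so at an inner vertex of the path both path edges through it
  contribute their weight to the eigenvalue equation. Bounding each weight below by
  \<open>edge_weight_ge\<close> gives the hypothesis of \<open>recurrence_comparison\<close>.
\<close>

lemma entry_le_along_path:
  fixes x :: "nat \<Rightarrow> real"
  assumes hyp: "hypergraph n E" and uni: "uniform r E" and "r \<ge> 1" and "\<rho> > 0"
    and eig: "is_eigenvector r n (adjacency_tensor r E) (complex_of_real \<rho>) (\<lambda>i. complex_of_real (x i))"
    and pos: "\<And>i. i \<in> {1..n} \<Longrightarrow> x i > 0"
    and joined: "joined n E v u l"
    and U: "U 0 = 1" "U 1 = sqrt (\<rho> ^ r)" "\<And>k. U (k + 2) = sqrt (\<rho> ^ r) * U (k + 1) - U k" "\<And>k. U k > 0"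
  shows "x u / x v \<le> root r ((U l)\<^sup>2)"
proof -
  obtain vs es where path: "is_path n E vs es" and ends: "hd vs = v" "last vs = u" and l: "length es = l"
    using joined unfolding joined_def by blast
  have len: "length vs = l + 1" and vs: "set vs \<subseteq> {1..n}" and es: "set es \<subseteq> E"
    and dist: "distinct vs" "distinct es"
    and inc: "\<And>i. i < l \<Longrightarrow> vs ! i \<in> es ! i \<and> vs ! Suc i \<in> es ! i"
    using path l by (auto simp: is_path_def)
  have E: "finite e" "e \<subseteq> {1..n}" "card e = r" if "e \<in> E" for e
    using that hyp uni finite_subset[of e "{1..n}"] by (auto simp: hypergraph_def uniform_def)
  have finE: "finite E"
    using E by (meson Pow_iff finite_Pow_iff finite_atLeastAtMost finite_subset subsetI)
  define s where "s = sqrt (\<rho> ^ r)"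
  define w where "w e = (\<Prod>j\<in>e. x j)" for e
  define y where "y k = sqrt (x (vs ! k) ^ r)" for k
  have wpos: "w e > 0" if "e \<in> E" for e
    unfolding w_def using E[OF that] pos by (intro prod_pos) auto
  have edges_le: "(\<Sum>e\<in>F. w e) \<le> \<rho> * x i ^ r" if "i \<in> {1..n}" "F \<subseteq> {e \<in> E. i \<in> e}" for i F
    unfolding eigenvector_edge_equation[OF hyp uni \<open>r \<ge> 1\<close> that(1) eig] w_def[symmetric]
    using that finE wpos by (intro sum_mono2) (auto intro: less_imp_le)
  have vsI: "vs ! k \<in> {1..n}" if "k \<le> l" for k
    using vs len that by (metis Suc_eq_plus1 le_imp_less_Suc nth_mem subsetD)
  have esI: "es ! k \<in> E" if "k < l" for k
    using es l that nth_mem by blast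
  have ypos: "y k > 0" if "k \<le> l" for k
    using pos[OF vsI[OF that]] by (simp add: y_def)
  have ysq: "(y k)\<^sup>2 = x (vs ! k) ^ r" if "k \<le> l" for k
    using pos[OF vsI[OF that]] by (simp add: y_def)
  have edge: "\<rho> * y k * y (Suc k) \<le> s * w (es ! k)" if "k < l" for k
    unfolding y_def w_def s_def
  proof (rule edge_weight_ge)
    show "vs ! k \<noteq> vs ! Suc k"
      using dist(1) len that by (simp add: nth_eq_iff_index_eq)
    fix j assume j: "j \<in> es ! k"
    then have jn: "j \<in> {1..n}" using E[OF esI[OF that]] by auto
    then show "x j > 0" by (rule pos)
    show "(\<Prod>j\<in>es ! k. x j) \<le> \<rho> * x j ^ r"
      using edges_le[OF jn, of "{es ! k}"] j esI[OF that] by (simp add: w_def)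
  qed (use that inc E esI \<open>\<rho> > 0\<close> in auto)
  have spos: "s > 0" using \<open>\<rho> > 0\<close> by (simp add: s_def)
  have "y l \<le> U l * y 0"
  proof (rule recurrence_comparison[where s = s])
    assume "l \<ge> 1"
    then have "\<rho> * y 0 * y 1 \<le> s * w (es ! 0)" using edge[of 0] by simp
    also have "w (es ! 0) \<le> \<rho> * x (vs ! 0) ^ r"
      using edges_le[OF vsI[of 0], of "{es ! 0}"] \<open>l \<ge> 1\<close> esI inc by simp
    then have "s * w (es ! 0) \<le> s * (\<rho> * (y 0)\<^sup>2)"
      using spos ysq[of 0] by simp
    finally have "(\<rho> * y 0) * y 1 \<le> (\<rho> * y 0) * (s * y 0)"
      by (simp add: power2_eq_square mult_ac)
    then show "y 1 \<le> s * y 0" using \<open>\<rho> > 0\<close> ypos[of 0] by simp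
  next
    fix k assume k: "k + 2 \<le> l"
    have ne: "es ! k \<noteq> es ! Suc k"
      using dist(2) l k by (simp add: nth_eq_iff_index_eq)
    have "\<rho> * y k * y (k + 1) + \<rho> * y (k + 1) * y (k + 2) \<le> s * (w (es ! k) + w (es ! Suc k))"
      using edge[of k] edge[of "Suc k"] k by (simp add: distrib_left)
    also have "w (es ! k) + w (es ! Suc k) \<le> \<rho> * (y (k + 1))\<^sup>2"
      using edges_le[OF vsI[of "k + 1"], of "{es ! k, es ! Suc k}"] k esI inc[of k] inc[of "Suc k"] ne
      by (simp add: ysq)
    then have "s * (w (es ! k) + w (es ! Suc k)) \<le> s * (\<rho> * (y (k + 1))\<^sup>2)"
      using spos by simp
    finally have "(\<rho> * y (k + 1)) * (y (k + 2) + y k) \<le> (\<rho> * y (k + 1)) * (s * y (k + 1))"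
      by (simp add: power2_eq_square algebra_simps)
    then show "y (k + 2) + y k \<le> s * y (k + 1)"
      using \<open>\<rho> > 0\<close> ypos[of "k + 1"] k by simp
  qed (use U in \<open>simp_all add: s_def\<close>)
  then have "(y l)\<^sup>2 \<le> (U l * y 0)\<^sup>2"
    using ypos[of l] by (intro power_mono) auto
  moreover have "vs ! 0 = v" "vs ! l = u"
    using ends len hd_conv_nth[of vs] last_conv_nth[of vs] by (cases "vs = []"; simp)+
  ultimately have le: "x u ^ r \<le> (U l)\<^sup>2 * x v ^ r"
    using ysq[of l] ysq[of 0] by (simp add: power_mult_distrib)
  have "x u > 0" "x v > 0"
    using pos vsI[of 0] vsI[of l] \<open>vs ! 0 = v\<close> \<open>vs ! l = u\<close> by auto
  then have "(x u / x v) ^ r \<le> (U l)\<^sup>2"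
    using le by (simp add: power_divide divide_simps)
  then have "root r ((x u / x v) ^ r) \<le> root r ((U l)\<^sup>2)"
    using \<open>r \<ge> 1\<close> by (intro real_root_le_mono) auto
  then show ?thesis
    using \<open>r \<ge> 1\<close> \<open>x u > 0\<close> \<open>x v > 0\<close> by (simp add: real_root_power_cancel)
qed

section \<open>Bounds for the ratio of two entries\<close>

lemma joined_sym:
  assumes "joined n E u v l"
  shows "joined n E v u l"
proof -
  obtain vs es where p: "is_path n E vs es" "hd vs = u" "last vs = v" "length es = l"
    using assms unfolding joined_def by blast
  have len: "length vs = l + 1" using p by (simp add: is_path_def)
  have "is_path n E (rev vs) (rev es)"
    unfolding is_path_def
  proof (intro conjI allI impI)
    fix i assume i: "i < length (rev es)"
    have "vs ! (l - Suc i) \<in> es ! (l - Suc i)" "vs ! Suc (l - Suc i) \<in> es ! (l - Suc i)"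
      using p i by (auto simp: is_path_def)
    moreover have "Suc (l - Suc i) = l - i" using i p by simp
    ultimately show "rev vs ! i \<in> rev es ! i" "rev vs ! Suc i \<in> rev es ! i"
      using i p len by (auto simp: rev_nth)
  qed (use p in \<open>auto simp: is_path_def\<close>)
  moreover have "hd (rev vs) = v" "last (rev vs) = u"
    using p len by (auto simp: hd_rev last_rev)
  ultimately show ?thesis
    unfolding joined_def using p(4) by (metis length_rev)
qed

lemma entry_ratio_bounds:
  fixes x :: "nat \<Rightarrow> real"
  assumes "hypergraph n E" "uniform r E" "connected_hypergraph n E" "r \<ge> 1" "\<rho> > 0"
    and "is_eigenvector r n (adjacency_tensor r E) (complex_of_real \<rho>) (\<lambda>i. complex_of_real (x i))"
    and pos: "\<And>i. i \<in> {1..n} \<Longrightarrow> x i > 0"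
    and uv: "u \<in> {1..n}" "v \<in> {1..n}"
    and U: "U 0 = 1" "U 1 = sqrt (\<rho> ^ r)" "\<And>k. U (k + 2) = sqrt (\<rho> ^ r) * U (k + 1) - U k" "\<And>k. U k > 0"
  shows "1 / root r ((U (distance n E u v))\<^sup>2) \<le> x u / x v"
    and "x u / x v \<le> root r ((U (distance n E u v))\<^sup>2)"
proof -
  let ?l = "distance n E u v"
  have uvl: "joined n E u v ?l"
    using assms(3) uv unfolding connected_hypergraph_def distance_def by (meson LeastI)
  show "x u / x v \<le> root r ((U ?l)\<^sup>2)"
    by (rule entry_le_along_path[OF assms(1,2,4-7) joined_sym[OF uvl] U])
  have "x v / x u \<le> root r ((U ?l)\<^sup>2)"
    by (rule entry_le_along_path[OF assms(1,2,4-7) uvl U])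
  moreover have "root r ((U ?l)\<^sup>2) > 0" using U(4)[of ?l] \<open>r \<ge> 1\<close> by simp
  ultimately show "1 / root r ((U ?l)\<^sup>2) \<le> x u / x v"
    using pos[OF uv(1)] pos[OF uv(2)] by (simp add: field_simps)
qed

theorem theorem3p4:
  fixes r n l u v :: nat and E :: "nat set set" and \<rho> :: real and x :: "nat \<Rightarrow> real"
  assumes "r \<ge> 2"
    and "hypergraph n E"
    and "uniform r E"
    and "connected_hypergraph n E"
    and "\<rho> = spectral_radius r n E"
    and "principal_eigenvector r n E x"
    and "u \<in> {1..n}" and "v \<in> {1..n}"
    and "distance n E u v = l"
  shows "(\<rho> > root r 4 \<longrightarrow>
           (let \<sigma> = 1 / 2 * (sqrt (\<rho> ^ r) + sqrt (\<rho> ^ r - 4)) in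
              ((\<sigma> - inverse \<sigma>) / (\<sigma> ^ (l + 1) - inverse (\<sigma> ^ (l + 1)))) powr (2 / real r)
                \<le> x u / x v \<and>
              x u / x v
                \<le> ((\<sigma> ^ (l + 1) - inverse (\<sigma> ^ (l + 1))) / (\<sigma> - inverse \<sigma>)) powr (2 / real r))) \<and>
         (\<rho> = root r 4 \<longrightarrow>
           1 / root r ((real l + 1)\<^sup>2) \<le> x u / x v \<and>
           x u / x v \<le> root r ((real l + 1)\<^sup>2))"
proof -
  have "r \<ge> 1" "r > 0" using assms(1) by auto
  have eig: "is_eigenvector r n (adjacency_tensor r E) (complex_of_real \<rho>) (\<lambda>i. complex_of_real (x i))"
    and pos: "\<And>i. i \<in> {1..n} \<Longrightarrow> x i > 0"
    using assms(5,6) by (auto simp: principal_eigenvector_def)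
  have four: "root r 4 > 0" "root r 4 ^ r = 4" using \<open>r > 0\<close> by auto
  note bounds = entry_ratio_bounds[OF assms(2-4) \<open>r \<ge> 1\<close> _ eig pos assms(7,8), unfolded assms(9)]
  show ?thesis
  proof (intro conjI[of "_ \<longrightarrow> _"] impI)
    assume \<rho>: "\<rho> > root r 4"
    then have "\<rho> > 0" using four by linarith
    have "root r 4 ^ r < \<rho> ^ r" using \<rho> four \<open>r > 0\<close> by (intro power_strict_mono) auto
    then have \<rho>4: "\<rho> ^ r > 4" using four by simp
    define s where "s = sqrt (\<rho> ^ r)"
    define t where "t = sqrt (\<rho> ^ r - 4)"
    define \<sigma> where "\<sigma> = 1 / 2 * (s + t)"
    define U where "U k = (\<sigma> ^ (k + 1) - inverse (\<sigma> ^ (k + 1))) / (\<sigma> - inverse \<sigma>)" for k :: nat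
    have "sqrt 4 < s" unfolding s_def using \<rho>4 by (intro real_sqrt_less_mono)
    then have s2: "s > 2" by simp
    have t0: "t > 0" using \<rho>4 by (simp add: t_def)
    have \<sigma>1: "\<sigma> > 1" using s2 t0 by (simp add: \<sigma>_def)
    have st: "s\<^sup>2 - t\<^sup>2 = 4" using \<rho>4 by (simp add: s_def t_def)
    \<comment> \<open>\<open>\<sigma>\<close> and its inverse are the roots of \<open>z\<^sup>2 - s z + 1\<close>.\<close>
    have "\<sigma> * (1 / 2 * (s - t)) = 1"
      using st by (simp add: \<sigma>_def power2_eq_square algebra_simps)
    then have inv: "inverse \<sigma> = 1 / 2 * (s - t)" by (rule inverse_unique)
    then have s: "s = \<sigma> + inverse \<sigma>" unfolding inv by (simp add: \<sigma>_def field_simps)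
    have "inverse \<sigma> < 1" using \<sigma>1 by (simp add: inverse_less_1_iff)
    then have den: "\<sigma> - inverse \<sigma> > 0" using \<sigma>1 by linarith
    have Upos: "U k > 0" for k
    proof -
      have "\<sigma> ^ (k + 1) > 1" using \<sigma>1 by (intro one_less_power) auto
      then have "inverse (\<sigma> ^ (k + 1)) < \<sigma> ^ (k + 1)"
        by (meson inverse_less_1_iff less_trans)
      then show ?thesis using den by (simp add: U_def)
    qed
    have U0: "U 0 = 1" using den by (simp add: U_def)
    have U1: "U 1 = s"
    proof -
      have "\<sigma>\<^sup>2 - (inverse \<sigma>)\<^sup>2 = s * (\<sigma> - inverse \<sigma>)"
        by (simp add: s power2_eq_square algebra_simps)
      then show ?thesis using den by (simp add: U_def power_inverse power2_eq_square)
    qed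
    have U2: "U (k + 2) = s * U (k + 1) - U k" for k
    proof -
      have "\<sigma> ^ (k + 3) - inverse (\<sigma> ^ (k + 3))
          = s * (\<sigma> ^ (k + 2) - inverse (\<sigma> ^ (k + 2))) - (\<sigma> ^ (k + 1) - inverse (\<sigma> ^ (k + 1)))"
        using \<sigma>1 by (simp add: s field_simps power_add power2_eq_square power3_eq_cube)
      then show ?thesis
        using den by (simp add: U_def diff_divide_distrib[symmetric] eval_nat_numeral)
    qed
    have "U l powr (2 / real r) = root r ((U l)\<^sup>2)"
      using Upos[of l] \<open>r > 0\<close> by (simp add: root_powr_inverse powr_powr flip: powr_numeral)
    moreover have "(1 / U l) powr (2 / real r) = 1 / U l powr (2 / real r)"
      using Upos[of l] by (simp add: powr_divide)
    moreover have "(\<sigma> - inverse \<sigma>) / (\<sigma> ^ (l + 1) - inverse (\<sigma> ^ (l + 1))) = 1 / U l"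
      by (simp add: U_def)
    ultimately have "((\<sigma> - inverse \<sigma>) / (\<sigma> ^ (l + 1) - inverse (\<sigma> ^ (l + 1)))) powr (2 / real r) \<le> x u / x v \<and>
        x u / x v \<le> U l powr (2 / real r)"
      using bounds[OF \<open>\<rho> > 0\<close> _ U0 U1[unfolded s_def] U2[unfolded s_def] Upos] by simp
    then show "let \<sigma> = 1 / 2 * (sqrt (\<rho> ^ r) + sqrt (\<rho> ^ r - 4)) in
        ((\<sigma> - inverse \<sigma>) / (\<sigma> ^ (l + 1) - inverse (\<sigma> ^ (l + 1)))) powr (2 / real r) \<le> x u / x v \<and>
        x u / x v \<le> ((\<sigma> ^ (l + 1) - inverse (\<sigma> ^ (l + 1))) / (\<sigma> - inverse \<sigma>)) powr (2 / real r)"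
      by (simp only: Let_def U_def \<sigma>_def s_def t_def)
  next
    assume \<rho>: "\<rho> = root r 4"
    have "sqrt (\<rho> ^ r) = 2" using four \<rho> by simp
    then show "1 / root r ((real l + 1)\<^sup>2) \<le> x u / x v \<and> x u / x v \<le> root r ((real l + 1)\<^sup>2)"
      using bounds[of "\<lambda>k. real k + 1"] four \<rho> by (auto simp: algebra_simps)
  qed
qed

end
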